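(* Let $G$ be a connected graph with $m = |V(G)| > 1$ and let $H$ be a connected graph with $n = |V(H)|$. Then $$\mathcal{V}(G\odot H) = \mathcal{V}(G) + \left((1+x)^{mn}-1\right) + m x\left(\mathcal{V}_2(H)-1\right) + \sum_Q p_Q(x),$$ where the sum runs over all non-empty proper subsets $Q \subsetneq V(G)$ that are mutual-visibility sets of $G$, and $$p_Q(x) = \begin{cases} \displaystyle\sum_{\Omega_Q(G)} \left((1+x)^{|\Omega_Q(G)|\,n}-1\right)x^{|Q|} & \text{if } Q \text{ is disjoint-visible},\\[8pt] \displaystyle\sum_{\emptyset\neq \mathcal{J}\subseteq \Gamma_Q(G)} (-1)^{|\mathcal{J}|+1}\left((1+x)^{\left|\bigcap_{W\in\mathcal{J}} W\right|\,n}-1\right)x^{|Q|} & \text{otherwise},\end{cases}$$ with the sum in the first case over all maximal absolute $c_Q$-visible sets $\Omega_Q(G)$ of $G$.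
   Context: All graphs are finite, simple, undirected and connected. For a graph $G$ and $X \subseteq V(G)$, two vertices $u,v$ are $X$-visible if there exists a shortest $(u,v)$-path $P$ in $G$ with $V(P)\cap X \subseteq \{u,v\}$; a set $Y$ is $X$-visible if every two vertices of $Y$ are $X$-visible. A set $X\subseteq V(G)$ is a mutual-visibility set of $G$ if it is $X$-visible (the empty set counts). The visibility polynomial is $\mathcal{V}(G)=\sum_{i\ge0} r_i x^i$, where $r_i$ is the number of mutual-visibility sets of $G$ of cardinality $i$. For $X\subseteq V(G)$, $\operatorname{diam}_G(X)=\max_{u,v\in X}d_G(u,v)$. The diameter-restricted visibility polynomial is $\mathcal{V}_d(G)=\sum_{i\ge 0} r_{i,d}x^i$, where $r_{i,d}$ is the number of mutual-visibility sets of $G$ of cardinality $i$ with $\operatorname{diam}_G$ at most $d$ (so $r_{0,d}=1$). For $Q\subseteq V(G)$, a set $W\subseteq \overline{Q}=V(G)\setminus Q$ is $c_Q$-visible if $W$ is $Q$-visible and $u,w$ are $Q$-visible for all $u\in Q$, $w\in W$; it is an absolute $c_Q$-visible set if moreover $Q$ is a mutual-visibility set of $G$. A maximal absolute $c_Q$-visible set (one not properly contained in another absolute $c_Q$-visible set) is denoted $\Omega_Q(G)$, and $\Gamma_Q(G)$ is the collection of all of them. $Q$ is disjoint-visible if, whenever there is more than one maximal absolute $c_Q$-visible set, these sets are pairwise disjoint. The corona $G\odot H$ is obtained from one copy of $G$ and $|V(G)|$ copies of $H$, the copy associated with $v\in V(G)$ being denoted $H_v$, by joining each $v \in V(G)$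 to every vertex of $H_v$. *)

theory Defs
  imports "Graph_Theory.Graph_Theory" "HOL-Computational_Algebra.Polynomial"
begin

text \<open>
  Finite simple undirected graphs are \<^locale>\<open>pair_graph\<close>s: finite, loop-free, symmetric digraphs
  without parallel arcs. The distance is the shortest-path cost for unit arc weights.
\<close>

definition gdist :: "'a pair_pre_digraph \<Rightarrow> 'a \<Rightarrow> 'a \<Rightarrow> ereal" where
  "gdist G u v = wf_digraph.\<mu> (with_proj G) (\<lambda>_. 1) u v"

text \<open>A path is a list of arcs, so its length is the length of that list.\<close>

definition shortest_path :: "'a pair_pre_digraph \<Rightarrow> 'a \<Rightarrow> ('a \<times> 'a) awalk \<Rightarrow> 'a \<Rightarrow> bool" where
  "shortest_path G u p v \<longleftrightarrow>
     pre_digraph.apath (with_proj G) u p v \<and> ereal (real (length p)) = gdist G u v"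

definition path_verts :: "'a pair_pre_digraph \<Rightarrow> 'a \<Rightarrow> ('a \<times> 'a) awalk \<Rightarrow> 'a set" where
  "path_verts G u p = set (pre_digraph.awalk_verts (with_proj G) u p)"

text \<open>As a supremum in \<^typ>\<open>ereal\<close>, the diameter of the empty set is \<open>-\<infinity>\<close>,
  so the empty set has diameter at most \<open>d\<close> for every \<open>d\<close>.\<close>

definition set_diam :: "'a pair_pre_digraph \<Rightarrow> 'a set \<Rightarrow> ereal" where
  "set_diam G X = (SUP (u, v) \<in> X \<times> X. gdist G u v)"


definition visible :: "'a pair_pre_digraph \<Rightarrow> 'a set \<Rightarrow> 'a \<Rightarrow> 'a \<Rightarrow> bool" where
  "visible G X u v \<longleftrightarrow> (\<exists>p. shortest_path G u p v \<and> path_verts G u p \<inter> X \<subseteq> {u, v})"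

definition visible_set :: "'a pair_pre_digraph \<Rightarrow> 'a set \<Rightarrow> 'a set \<Rightarrow> bool" where
  "visible_set G X Y \<longleftrightarrow> (\<forall>u\<in>Y. \<forall>v\<in>Y. visible G X u v)"

definition mutual_visibility_set :: "'a pair_pre_digraph \<Rightarrow> 'a set \<Rightarrow> bool" where
  "mutual_visibility_set G X \<longleftrightarrow> X \<subseteq> pverts G \<and> visible_set G X X"

text \<open>Both polynomials are truncated at \<open>i = |V(G)|\<close>, beyond which all coefficients vanish.\<close>

definition visibility_poly :: "'a pair_pre_digraph \<Rightarrow> int poly" where
  "visibility_poly G =
     (\<Sum>i\<le>card (pverts G). monom (int (card {X. mutual_visibility_set G X \<and> card X = i})) i)"

definition diam_visibility_poly :: "nat \<Rightarrow> 'a pair_pre_digraph \<Rightarrow> int poly" where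
  "diam_visibility_poly d G =
     (\<Sum>i\<le>card (pverts G).
        monom (int (card {X. mutual_visibility_set G X \<and> card X = i
                             \<and> set_diam G X \<le> ereal (real d)})) i)"


definition c_visible :: "'a pair_pre_digraph \<Rightarrow> 'a set \<Rightarrow> 'a set \<Rightarrow> bool" where
  "c_visible G Q W \<longleftrightarrow>
     W \<subseteq> pverts G - Q \<and> visible_set G Q W \<and> (\<forall>u\<in>Q. \<forall>w\<in>W. visible G Q u w)"

definition abs_c_visible :: "'a pair_pre_digraph \<Rightarrow> 'a set \<Rightarrow> 'a set \<Rightarrow> bool" where
  "abs_c_visible G Q W \<longleftrightarrow> c_visible G Q W \<and> mutual_visibility_set G Q"

definition max_abs_c_visible_sets :: "'a pair_pre_digraph \<Rightarrow> 'a set \<Rightarrow> 'a set set" where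
  "max_abs_c_visible_sets G Q =
     {W. abs_c_visible G Q W \<and> \<not> (\<exists>W'. abs_c_visible G Q W' \<and> W \<subset> W')}"

definition disjoint_visible :: "'a pair_pre_digraph \<Rightarrow> 'a set \<Rightarrow> bool" where
  "disjoint_visible G Q \<longleftrightarrow>
     (card (max_abs_c_visible_sets G Q) > 1 \<longrightarrow> pairwise disjnt (max_abs_c_visible_sets G Q))"


text \<open>The vertex \<open>Inr (v, a)\<close> is the vertex \<open>a\<close> of the copy of \<open>H\<close> associated with \<open>v\<close>.\<close>

definition corona ::
  "'a pair_pre_digraph \<Rightarrow> 'b pair_pre_digraph \<Rightarrow> ('a + 'a \<times> 'b) pair_pre_digraph" where
  "corona G H =
     \<lparr> pverts = Inl ` pverts G \<union> Inr ` (pverts G \<times> pverts H),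
       parcs = {(Inl u, Inl v) |u v. (u, v) \<in> parcs G}
             \<union> {(Inr (v, a), Inr (v, b)) |v a b. v \<in> pverts G \<and> (a, b) \<in> parcs H}
             \<union> {(Inl v, Inr (v, a)) |v a. v \<in> pverts G \<and> a \<in> pverts H}
             \<union> {(Inr (v, a), Inl v) |v a. v \<in> pverts G \<and> a \<in> pverts H} \<rparr>"

lemma pair_graph_corona:
  assumes "pair_graph G" "pair_graph H"
  shows "pair_graph (corona G H)"
proof -
  interpret G: pair_graph G by fact
  interpret H: pair_graph H by fact
  have fin: "finite (pverts (corona G H))"
    by (simp add: corona_def G.pair_finite_verts H.pair_finite_verts)
  have G: "u \<in> pverts G \<and> v \<in> pverts G \<and> u \<noteq> v" if "(u, v) \<in> parcs G" for u v
    using G.arc_fst_in_verts[OF that] G.arc_snd_in_verts[OF that] G.pair_no_loops[OF that] by simp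
  have H: "u \<in> pverts H \<and> v \<in> pverts H \<and> u \<noteq> v" if "(u, v) \<in> parcs H" for u v
    using H.arc_fst_in_verts[OF that] H.arc_snd_in_verts[OF that] H.pair_no_loops[OF that] by simp
  have sub: "parcs (corona G H) \<subseteq> pverts (corona G H) \<times> pverts (corona G H)"
    by (auto simp: corona_def dest: G H)
  have loop: "fst e \<noteq> snd e" if "e \<in> parcs (corona G H)" for e
    using that by (auto simp: corona_def dest: G H)
  have "sym (parcs G)" "sym (parcs H)"
    using G.pair_sym_arcs H.pair_sym_arcs by (simp_all add: symmetric_def)
  then have "sym (parcs (corona G H))"
    unfolding sym_def corona_def by auto
  then show ?thesis
    using fin sub loop finite_subset[OF sub]
    by unfold_locales (auto simp: symmetric_def)
qed


text \<open>The indeterminate \<open>x\<close> is \<^term>\<open>[:0, 1:] :: int poly\<close>, and \<open>1 + x\<close> is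
  \<^term>\<open>[:1, 1:] :: int poly\<close>.\<close>

definition p_poly :: "'a pair_pre_digraph \<Rightarrow> nat \<Rightarrow> 'a set \<Rightarrow> int poly" where
  "p_poly G n Q =
     (if disjoint_visible G Q
      then \<Sum>W \<in> max_abs_c_visible_sets G Q.
             ([:1, 1:] ^ (card W * n) - 1) * [:0, 1:] ^ card Q
      else \<Sum>J \<in> {J. J \<noteq> {} \<and> J \<subseteq> max_abs_c_visible_sets G Q}.
             (- 1) ^ (card J + 1) * ([:1, 1:] ^ (card (\<Inter>J) * n) - 1) * [:0, 1:] ^ card Q)"

end

theory Submission
  imports Defs
begin

text \<open>
  A vertex set of the corona is a disjoint sum \<open>Q <+> Y\<close> with \<open>Q\<close> in \<open>G\<close> and \<open>Y\<close> in the copies of \<open>H\<close>.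
  Vertices over different vertices \<open>v\<close>, \<open>w\<close> of \<open>G\<close> see each other iff \<open>v\<close> and \<open>w\<close> do in \<open>G\<close> and no
  vertex of \<open>Q\<close> cuts off a copy of \<open>H\<close>. Vertices of the same copy over \<open>v\<close> see each other
  through \<open>v\<close> if \<open>v \<notin> Q\<close>; otherwise they have to do so inside \<open>H\<close>, within distance \<open>2\<close>.
  Hence the mutual-visibility sets fall into four classes, one for each summand: \<open>Y = {}\<close>; \<open>Q = {}\<close>
  (any \<open>Y\<close> works); \<open>Q = {v}\<close> with \<open>Y\<close> in the copy over \<open>v\<close>; and the
  projection of \<open>Y\<close> is a nonempty absolute \<open>c_Q\<close>-visible set. As absolute \<open>c_Q\<close>-visibility passes to
  subsets, the sets \<open>Y\<close> of the last class form the union of the \<open>Pow (W \<times> V(H)) - {{}}\<close>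
  for \<open>W\<close> maximal, to which inclusion-exclusion applies.
\<close>

subsection \<open>Walks and geodesics\<close>

text \<open>Walks are kept as vertex lists rather than arc lists, so that projecting, lifting and
  reversing them become list operations. The list of a walk with k arcs has length k + 1.\<close>

inductive vertex_walk :: "'a pair_pre_digraph \<Rightarrow> 'a \<Rightarrow> 'a list \<Rightarrow> 'a \<Rightarrow> bool" for G where
  trivial: "u \<in> pverts G \<Longrightarrow> vertex_walk G u [u] u"
| step: "(u, w) \<in> parcs G \<Longrightarrow> vertex_walk G w xs v \<Longrightarrow> vertex_walk G u (u # xs) v"

text \<open>Minimality is taken among all walks and measured by list length, so comparisons stay in
  \<open>nat\<close> and repeated vertices need no separate treatment.\<close>

definition geodesic :: "'a pair_pre_digraph \<Rightarrow> 'a \<Rightarrow> 'a list \<Rightarrow> 'a \<Rightarrow> bool" where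
  "geodesic G u xs v \<longleftrightarrow> vertex_walk G u xs v \<and> (\<forall>ys. vertex_walk G u ys v \<longrightarrow> length xs \<le> length ys)"

lemma vertex_walk_last_in_set: "vertex_walk G u xs v \<Longrightarrow> v \<in> set xs"
  by (induction rule: vertex_walk.induct) auto

lemma vertex_walk_hd_in_set: "vertex_walk G u xs v \<Longrightarrow> u \<in> set xs"
  by (induction rule: vertex_walk.induct) auto

lemma vertex_walk_length_pos: "vertex_walk G u xs v \<Longrightarrow> 1 \<le> length xs"
  by (induction rule: vertex_walk.induct) auto

lemma vertex_walk_snoc:
  assumes "vertex_walk G u xs v" "(v, w) \<in> parcs G" "w \<in> pverts G"
  shows "vertex_walk G u (xs @ [w]) w"
  using assms by (induction rule: vertex_walk.induct) (auto intro: vertex_walk.intros)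

lemma vertex_walk_map:
  assumes "vertex_walk G u xs v"
    and "\<And>w. w \<in> pverts G \<Longrightarrow> f w \<in> pverts K"
    and "\<And>w w'. (w, w') \<in> parcs G \<Longrightarrow> (f w, f w') \<in> parcs K"
  shows "vertex_walk K (f u) (map f xs) (f v)"
  using assms by (induction rule: vertex_walk.induct) (auto intro: vertex_walk.intros)

lemma vertex_walk_imp_geodesic:
  assumes "vertex_walk G u xs v"
  obtains ys where "geodesic G u ys v"
  using arg_min_nat_lemma[of "\<lambda>ys. vertex_walk G u ys v" xs length] assms
  unfolding geodesic_def by blast

lemma geodesic_self: "u \<in> pverts G \<Longrightarrow> geodesic G u [u] u"
  unfolding geodesic_def by (auto intro: vertex_walk.trivial dest: vertex_walk_length_pos)

lemma vertex_walk_long: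
  assumes "vertex_walk G u xs v" "u \<noteq> v" "(u, v) \<notin> parcs G"
  shows "3 \<le> length xs"
  using assms(1)
proof cases
  case (step w ys)
  from step(3) show ?thesis
  proof cases
    case trivial then show ?thesis using step assms by auto
  next
    case (step w' zs)
    then show ?thesis using vertex_walk_length_pos[of G w' zs v] \<open>xs = u # ys\<close> by auto
  qed
qed (use assms in auto)

lemma geodesic_arc:
  assumes "(u, v) \<in> parcs G" "u \<noteq> v" "v \<in> pverts G"
  shows "geodesic G u [u, v] v"
proof -
  have "2 \<le> length ys" if "vertex_walk G u ys v" for ys
    using that
  proof cases
    case (step w zs)
    then show ?thesis using vertex_walk_length_pos[of G w zs v] by simp
  qed (use assms in auto)
  moreover have "vertex_walk G u [u, v] v"
    using assms by (auto intro: vertex_walk.intros)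
  ultimately show ?thesis by (simp add: geodesic_def numeral_2_eq_2)
qed

section \<open>Translation between vertex lists and arc walks\<close>

context pair_wf_digraph
begin

lemma vertex_walk_awalk_verts: "awalk u p v \<Longrightarrow> vertex_walk G u (awalk_verts u p) v"
  by (induction p arbitrary: u) (auto simp: awalk_simps intro!: vertex_walk.intros)

lemma vertex_walk_awalk:
  "vertex_walk G u xs v \<Longrightarrow> \<exists>p. awalk u p v \<and> awalk_verts u p = xs"
proof (induction rule: vertex_walk.induct)
  case (trivial u)
  then show ?case by (intro exI[of _ "[]"]) (auto simp: awalk_simps)
next
  case (step u w xs v)
  then obtain p where "awalk w p v" "awalk_verts w p = xs" by blast
  with step show ?case
    by (intro exI[of _ "(u, w) # p"]) (auto simp: awalk_simps in_arcsD1)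
qed

lemma awalk_cost_unit: "awalk_cost (\<lambda>_. 1) p = real (length p)"
  by (induction p) auto

lemma gdist_le_length: "vertex_walk G u xs v \<Longrightarrow> gdist G u v \<le> ereal (real (length xs - 1))"
proof -
  assume "vertex_walk G u xs v"
  then obtain p where p: "awalk u p v" "awalk_verts u p = xs"
    using vertex_walk_awalk by blast
  then have "length xs = Suc (length p)" using length_awalk_verts[of u p] by simp
  then show ?thesis
    using min_cost_le_walk_cost[OF p(1), of "\<lambda>_. 1"] by (simp add: gdist_def awalk_cost_unit)
qed

lemma gdist_geodesic:
  assumes "geodesic G u xs v"
  shows "gdist G u v = ereal (real (length xs - 1))"
proof (rule antisym)
  show "gdist G u v \<le> ereal (real (length xs - 1))"
    using assms gdist_le_length by (auto simp: geodesic_def)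
  have "length xs \<le> Suc (length p)" if "awalk u p v" for p
    using vertex_walk_awalk_verts[OF that] assms length_awalk_verts[of u p]
    by (auto simp: geodesic_def)
  \<comment> \<open>The distance is an infimum over all arc walks, so a bound valid for each of them
    suffices.\<close>
  then show "ereal (real (length xs - 1)) \<le> gdist G u v"
    unfolding gdist_def \<mu>_def
    by (intro INF_greatest) (fastforce simp: awalk_cost_unit)
qed

lemma shortest_path_imp_geodesic:
  assumes "shortest_path G u p v"
  shows "geodesic G u (awalk_verts u p) v"
proof -
  have p: "awalk u p v" and d: "gdist G u v = ereal (real (length p))"
    using assms by (auto simp: shortest_path_def apath_def)
  have w: "vertex_walk G u (awalk_verts u p) v" using p by (rule vertex_walk_awalk_verts)
  have "length (awalk_verts u p) \<le> length ys" if "vertex_walk G u ys v" for ys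
    using gdist_le_length[OF that] vertex_walk_length_pos[OF that] length_awalk_verts[of u p]
    by (auto simp: d)
  with w show ?thesis by (simp add: geodesic_def)
qed

text \<open>\<open>shortest_path\<close> asks for an \<open>apath\<close>, so vertices must not
  repeat. If one did, cutting out the closed part between two occurrences would give a shorter
  walk.\<close>

lemma geodesic_imp_shortest_path:
  assumes "geodesic G u xs v"
  obtains p where "shortest_path G u p v" "awalk_verts u p = xs"
proof -
  obtain p where p: "awalk u p v" "awalk_verts u p = xs"
    using vertex_walk_awalk assms unfolding geodesic_def by blast
  have "distinct (awalk_verts u p)"
  proof (rule ccontr)
    assume "\<not> distinct (awalk_verts u p)"
    then obtain q r s w where "p = q @ r @ s" "0 < length r" "awalk u q w" "awalk w s v"
      using awalk_not_distinct_decomp[OF p(1)] by blast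
    then have "awalk u (q @ s) v" "length (q @ s) < length p"
      by (auto intro: awalk_appendI)
    then have "length (awalk_verts u (q @ s)) < length xs" "vertex_walk G u (awalk_verts u (q @ s)) v"
      using vertex_walk_awalk_verts p(2) by (auto simp flip: p(2) simp: length_awalk_verts)
    then show False
      using assms leD unfolding geodesic_def by blast
  qed
  with p have "apath u p v" by (simp add: apath_def)
  moreover have "gdist G u v = ereal (real (length p))"
    using gdist_geodesic[OF assms] length_awalk_verts[of u p] p(2) by simp
  ultimately show thesis using that p(2) by (auto simp: shortest_path_def)
qed

text \<open>From here on visibility is treated through vertex lists only.\<close>

lemma visible_iff_geodesic:
  "visible G X u v \<longleftrightarrow> (\<exists>xs. geodesic G u xs v \<and> set xs \<inter> X \<subseteq> {u, v})"
proof
  assume "visible G X u v"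
  then show "\<exists>xs. geodesic G u xs v \<and> set xs \<inter> X \<subseteq> {u, v}"
    using shortest_path_imp_geodesic by (fastforce simp: visible_def path_verts_def)
next
  assume "\<exists>xs. geodesic G u xs v \<and> set xs \<inter> X \<subseteq> {u, v}"
  then obtain xs where "geodesic G u xs v" "set xs \<inter> X \<subseteq> {u, v}" by blast
  then show "visible G X u v"
    using geodesic_imp_shortest_path by (fastforce simp: visible_def path_verts_def)
qed

lemma visible_self: "u \<in> pverts G \<Longrightarrow> visible G X u u"
  using geodesic_self by (fastforce simp: visible_iff_geodesic)

end

lemma connected_imp_geodesic:
  assumes "pair_graph G" "Digraph_Component.connected (with_proj G)" "u \<in> pverts G" "v \<in> pverts G"
  obtains xs where "geodesic G u xs v"
proof -
  interpret pair_graph G by fact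
  \<comment> \<open>Connectedness refers to the symmetric closure, which has the same reachability
    because the arcs are already symmetric.\<close>
  have "u \<rightarrow>\<^sup>*\<^bsub>with_proj (mk_symmetric (with_proj G))\<^esub> v"
    using assms by (auto simp: connected_def)
  then have "u \<rightarrow>\<^sup>*\<^bsub>with_proj G\<^esub> v"
    using reachable_mk_symmetric_eq sym_arcs by blast
  then obtain p where "awalk u p v" by (auto simp: reachable_awalk)
  from vertex_walk_imp_geodesic[OF vertex_walk_awalk_verts[OF this]] that show thesis .
qed

subsection \<open>Visibility in the corona\<close>

lemma pverts_corona: "pverts (corona G H) = pverts G <+> pverts G \<times> pverts H"
  by (simp add: corona_def Plus_def)

lemma parcs_corona_iff:
  "(Inl u, Inl v) \<in> parcs (corona G H) \<longleftrightarrow> (u, v) \<in> parcs G"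
  "(Inl u, Inr p) \<in> parcs (corona G H) \<longleftrightarrow> fst p = u \<and> u \<in> pverts G \<and> snd p \<in> pverts H"
  "(Inr p, Inl u) \<in> parcs (corona G H) \<longleftrightarrow> fst p = u \<and> u \<in> pverts G \<and> snd p \<in> pverts H"
  "(Inr p, Inr q) \<in> parcs (corona G H) \<longleftrightarrow>
     fst p = fst q \<and> fst p \<in> pverts G \<and> (snd p, snd q) \<in> parcs H"
  by (cases p; cases q; force simp: corona_def)+

text \<open>The projection of the corona onto G that collapses each copy of H to the vertex it is
  attached to.\<close>

fun base :: "'a + 'a \<times> 'b \<Rightarrow> 'a" where
  "base (Inl v) = v"
| "base (Inr (v, a)) = v"

text \<open>The distance from a vertex of the corona to the copy of G, that is, the number of arcs
  an end of a walk adds to its projection.\<close>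

fun height :: "'a + 'a \<times> 'b \<Rightarrow> nat" where
  "height (Inl v) = 0"
| "height (Inr p) = 1"

lemma base_Inr [simp]: "base (Inr p) = fst p"
  by (cases p) simp

text \<open>Projecting a walk to the copy of \<open>G\<close> only fails if it never leaves a single copy of \<open>H\<close>.\<close>

lemma corona_walk_project:
  assumes "vertex_walk (corona G H) x zs y"
  shows "(\<exists>xs. vertex_walk G (base x) xs (base y) \<and> Inl ` set xs \<subseteq> set zs
            \<and> length xs + height x + height y \<le> length zs)
       \<or> (\<exists>v a b as. x = Inr (v, a) \<and> y = Inr (v, b) \<and> vertex_walk H a as b
            \<and> zs = map (\<lambda>c. Inr (v, c)) as)"
    (is "?up x zs y \<or> ?in x zs y")
  using assms
proof (induction rule: vertex_walk.induct)
  case (trivial x)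
  show ?case
  proof (cases x)
    case (Inl u)
    then have "vertex_walk G u [u] u" using trivial by (auto simp: pverts_corona intro: vertex_walk.trivial)
    then show ?thesis using Inl by (intro disjI1 exI[of _ "[u]"]) simp
  next
    case (Inr p)
    obtain v a where "p = (v, a)" by fastforce
    then have "vertex_walk H a [a] a" using trivial Inr by (auto simp: pverts_corona intro: vertex_walk.trivial)
    then show ?thesis using Inr \<open>p = (v, a)\<close> by (intro disjI2 exI[of _ v] exI[of _ a] exI[of _ "[a]"]) simp
  qed
next
  case (step x x' zs y)
  consider "?up x' zs y" | "?in x' zs y" using step.IH by blast
  then show ?case
  proof cases
    case 1
    then obtain xs where xs: "vertex_walk G (base x') xs (base y)" "Inl ` set xs \<subseteq> set zs"
      "length xs + height x' + height y \<le> length zs" by blast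
    show ?thesis
    proof (cases "isl x \<and> isl x'")
      case True
      then obtain u u' where "x = Inl u" "x' = Inl u'" by (auto simp: isl_def)
      then show ?thesis
        using step.hyps(1) xs
        by (intro disjI1 exI[of _ "u # xs"]) (auto simp: parcs_corona_iff intro: vertex_walk.step)
    next
      \<comment> \<open>An arc that touches a copy of H keeps the base and raises the height by at
        most one; the extra entry \<open>x\<close> of the list makes up for that.\<close>
      case False
      then have "base x = base x'" "height x \<le> height x' + 1"
        using step.hyps(1) by (cases x; cases x'; auto simp: parcs_corona_iff)+
      then show ?thesis
        using xs by (intro disjI1 exI[of _ xs]) auto
    qed
  next
    case 2
    then obtain v a b as where i: "x' = Inr (v, a)" "y = Inr (v, b)" "vertex_walk H a as b"
      "zs = map (\<lambda>c. Inr (v, c)) as" by blast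
    show ?thesis
    proof (cases x)
      \<comment> \<open>The walk now leaves the copy, so the first alternative takes over:
        \<open>[u]\<close> has length 1, the heights add 1, and the list for \<open>x\<close> has at
        least two entries.\<close>
      case (Inl u)
      then have "u = v" "v \<in> pverts G" using step.hyps(1) i by (auto simp: parcs_corona_iff)
      then show ?thesis
        using Inl i vertex_walk_length_pos[OF i(3)]
        by (intro disjI1 exI[of _ "[u]"]) (auto intro: vertex_walk.trivial)
    next
      case (Inr p)
      then obtain c where "x = Inr (v, c)" "(c, a) \<in> parcs H"
        using step.hyps(1) i by (cases p) (auto simp: parcs_corona_iff)
      then show ?thesis
        using i by (intro disjI2 exI[of _ v] exI[of _ c] exI[of _ b] exI[of _ "c # as"])
          (auto intro: vertex_walk.step)
    qed
  qed
qed

text \<open>The ends \<open>x\<close> and \<open>y\<close> are attached to the walk in G when they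
  lie outside the copy of G. The length equals the lower bound of
  \<open>corona_walk_project\<close>, so minimal walks correspond to minimal walks.\<close>

lemma corona_walk_lift:
  assumes "vertex_walk G (base x) xs (base y)" "x \<in> pverts (corona G H)" "y \<in> pverts (corona G H)"
  obtains zs where "vertex_walk (corona G H) x zs y" "set zs = {x, y} \<union> Inl ` set xs"
    "length zs = length xs + height x + height y"
proof -
  let ?K = "corona G H"
  define pre where "pre = (if isl x then [] else [x])"
  define post where "post = (if isl y then [] else [y])"
  have "vertex_walk ?K (Inl (base x)) (map Inl xs) (Inl (base y))"
    by (rule vertex_walk_map[OF assms(1)]) (auto simp: parcs_corona_iff pverts_corona)
  then have "vertex_walk ?K (Inl (base x)) (map Inl xs @ post) y"
    using assms(3) by (cases y) (auto simp: post_def parcs_corona_iff pverts_corona intro: vertex_walk_snoc)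
  then have "vertex_walk ?K x (pre @ map Inl xs @ post) y"
    using assms(2) by (cases x) (auto simp: pre_def parcs_corona_iff pverts_corona intro!: vertex_walk.step[rotated])
  moreover have "set (pre @ map Inl xs @ post) = {x, y} \<union> Inl ` set xs"
    using vertex_walk_hd_in_set[OF assms(1)] vertex_walk_last_in_set[OF assms(1)]
    by (cases x; cases y) (auto simp: pre_def post_def)
  moreover have "length (pre @ map Inl xs @ post) = length xs + height x + height y"
    by (cases x; cases y) (auto simp: pre_def post_def)
  ultimately show thesis using that by blast
qed

lemma corona_walk_lift_copy:
  assumes "vertex_walk H a as b" "v \<in> pverts G"
  shows "vertex_walk (corona G H) (Inr (v, a)) (map (\<lambda>c. Inr (v, c)) as) (Inr (v, b))"
  by (rule vertex_walk_map[OF assms(1)]) (use assms(2) in \<open>auto simp: parcs_corona_iff pverts_corona\<close>)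

text \<open>The excluded case is that of two vertices in the same copy of \<open>H\<close>.\<close>

lemma visible_corona_iff_geodesic:
  assumes "pair_graph G" "pair_graph H" "x \<in> pverts (corona G H)" "y \<in> pverts (corona G H)"
    and "base x \<noteq> base y \<or> isl x \<or> isl y"
  shows "visible (corona G H) X x y \<longleftrightarrow>
    (\<exists>xs. geodesic G (base x) xs (base y) \<and> Inl ` set xs \<inter> X \<subseteq> {x, y})"
    (is "_ \<longleftrightarrow> ?rhs")
proof -
  let ?K = "corona G H"
  interpret K: pair_graph ?K using assms by (intro pair_graph_corona)
  have project: "\<exists>xs. vertex_walk G (base x) xs (base y) \<and> Inl ` set xs \<subseteq> set zs
            \<and> length xs + height x + height y \<le> length zs" if "vertex_walk ?K x zs y" for zs
    using corona_walk_project[OF that] assms(5) by fastforce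
  show ?thesis
    unfolding K.visible_iff_geodesic
  proof
    assume "\<exists>zs. geodesic ?K x zs y \<and> set zs \<inter> X \<subseteq> {x, y}"
    then obtain zs where zs: "geodesic ?K x zs y" "set zs \<inter> X \<subseteq> {x, y}" by blast
    then obtain xs where xs: "vertex_walk G (base x) xs (base y)" "Inl ` set xs \<subseteq> set zs"
      "length xs + height x + height y \<le> length zs"
      using project unfolding geodesic_def by blast
    \<comment> \<open>A shorter walk in G would lift to a walk shorter than
      \<open>zs\<close>.\<close>
    have "length xs \<le> length ys" if ys: "vertex_walk G (base x) ys (base y)" for ys
    proof -
      obtain zs' where "vertex_walk ?K x zs' y" "length zs' = length ys + height x + height y"
        using corona_walk_lift[OF ys assms(3,4)] by blast
      then show ?thesis using zs(1) xs(3) unfolding geodesic_def by fastforce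
    qed
    then have "geodesic G (base x) xs (base y)" using xs(1) by (simp add: geodesic_def)
    then show ?rhs using xs(2) zs(2) by blast
  next
    assume ?rhs
    then obtain xs where xs: "geodesic G (base x) xs (base y)" "Inl ` set xs \<inter> X \<subseteq> {x, y}" by blast
    then obtain zs where zs: "vertex_walk ?K x zs y" "set zs = {x, y} \<union> Inl ` set xs"
      "length zs = length xs + height x + height y"
      using corona_walk_lift[OF _ assms(3,4)] unfolding geodesic_def by blast
    have "length zs \<le> length zs'" if zs': "vertex_walk ?K x zs' y" for zs'
    proof -
      obtain ys where "vertex_walk G (base x) ys (base y)" "length ys + height x + height y \<le> length zs'"
        using project[OF zs'] by blast
      moreover from this have "length xs \<le> length ys" using xs(1) by (simp add: geodesic_def)
      ultimately show ?thesis using zs(3) by linarith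
    qed
    then have "geodesic ?K x zs y" using zs(1) by (simp add: geodesic_def)
    then show "\<exists>zs. geodesic ?K x zs y \<and> set zs \<inter> X \<subseteq> {x, y}" using zs(2) xs(2) by blast
  qed
qed

text \<open>The attaching vertices of both ends lie on \<open>xs\<close>. If \<open>x\<close> is in
  a copy of H and its attaching vertex is in \<open>Q\<close>, the only way not to be blocked is
  that this vertex is the other end \<open>y\<close>. \<open>Y\<close> imposes nothing, since only
  vertices of G are met between the ends.\<close>

lemma Plus_inter_geodesic_iff:
  assumes "geodesic G (base x) xs (base y)"
  shows "Inl ` set xs \<inter> (Q <+> Y) \<subseteq> {x, y} \<longleftrightarrow>
    set xs \<inter> Q \<subseteq> {base x, base y} \<and> (\<not> isl x \<and> base x \<in> Q \<longrightarrow> y = Inl (base x))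
      \<and> (\<not> isl y \<and> base y \<in> Q \<longrightarrow> x = Inl (base y))"
proof -
  have "base x \<in> set xs" "base y \<in> set xs"
    using assms vertex_walk_hd_in_set vertex_walk_last_in_set unfolding geodesic_def by fast+
  then show ?thesis by (cases x; cases y) (auto 4 4)
qed

lemma visible_corona_iff:
  assumes "pair_graph G" "pair_graph H" "x \<in> pverts (corona G H)" "y \<in> pverts (corona G H)"
    and "base x \<noteq> base y \<or> isl x \<or> isl y"
  shows "visible (corona G H) (Q <+> Y) x y \<longleftrightarrow>
    visible G Q (base x) (base y) \<and> (\<not> isl x \<and> base x \<in> Q \<longrightarrow> y = Inl (base x))
      \<and> (\<not> isl y \<and> base y \<in> Q \<longrightarrow> x = Inl (base y))"
proof -
  interpret G: pair_graph G by fact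
  show ?thesis
    unfolding visible_corona_iff_geodesic[OF assms] G.visible_iff_geodesic
    using Plus_inter_geodesic_iff[of G x _ y Q Y] by blast
qed

text \<open>Vertices of one copy are at distance at most 2 in the corona: they are equal, adjacent,
  or joined by the detour through \<open>v\<close>, whose only inner vertex is outside
  \<open>Q\<close>.\<close>

lemma visible_corona_same_copy_free:
  assumes "pair_graph G" "pair_graph H" "v \<in> pverts G" "a \<in> pverts H" "b \<in> pverts H" "v \<notin> Q"
  shows "visible (corona G H) (Q <+> Y) (Inr (v, a)) (Inr (v, b))"
proof -
  let ?K = "corona G H"
  interpret K: pair_graph ?K using assms by (intro pair_graph_corona)
  have x: "Inr (v, a) \<in> pverts ?K" "Inr (v, b) \<in> pverts ?K" using assms by (auto simp: pverts_corona)
  consider "a = b" | "a \<noteq> b" "(a, b) \<in> parcs H" | "a \<noteq> b" "(a, b) \<notin> parcs H" by blast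
  then show ?thesis
  proof cases
    case 1
    then show ?thesis using K.visible_self x by blast
  next
    case 2
    then have "geodesic ?K (Inr (v, a)) [Inr (v, a), Inr (v, b)] (Inr (v, b))"
      using x assms by (intro geodesic_arc) (auto simp: parcs_corona_iff)
    then show ?thesis unfolding K.visible_iff_geodesic by fastforce
  next
    case 3
    let ?zs = "[Inr (v, a), Inl v, Inr (v, b)]"
    have "vertex_walk ?K (Inr (v, a)) ?zs (Inr (v, b))"
      using x assms by (auto simp: parcs_corona_iff intro!: vertex_walk.step[rotated] vertex_walk.trivial)
    moreover have "3 \<le> length zs" if "vertex_walk ?K (Inr (v, a)) zs (Inr (v, b))" for zs
      using that 3 by (intro vertex_walk_long) (auto simp: parcs_corona_iff)
    ultimately have "geodesic ?K (Inr (v, a)) ?zs (Inr (v, b))" by (simp add: geodesic_def numeral_3_eq_3)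
    then show ?thesis unfolding K.visible_iff_geodesic using assms(6) by fastforce
  qed
qed

text \<open>A walk that leaves the copy passes through \<open>v\<close>, which is in
  \<open>Q\<close>. So an unblocked shortest path stays in the copy and is a geodesic of H; it
  competes with the detour through \<open>v\<close>, whence the bound 2.\<close>

lemma visible_corona_same_copy_blocked:
  assumes "pair_graph G" "pair_graph H" "v \<in> pverts G" "a \<in> pverts H" "b \<in> pverts H" "v \<in> Q"
  shows "visible (corona G H) (Q <+> Y) (Inr (v, a)) (Inr (v, b)) \<longleftrightarrow>
    visible H {c. (v, c) \<in> Y} a b \<and> gdist H a b \<le> ereal (real 2)"
proof -
  let ?K = "corona G H" and ?x = "Inr (v, a)" and ?y = "Inr (v, b)"
  let ?copy = "map (\<lambda>c. Inr (v, c))"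
  interpret H: pair_graph H by fact
  interpret K: pair_graph ?K using assms by (intro pair_graph_corona)
  have x: "?x \<in> pverts ?K" "?y \<in> pverts ?K" using assms by (auto simp: pverts_corona)
  have project: "3 \<le> length zs \<and> Inl v \<in> set zs \<or> (\<exists>as. vertex_walk H a as b \<and> zs = ?copy as)"
    if "vertex_walk ?K ?x zs ?y" for zs
    using corona_walk_project[OF that]
  proof
    assume "\<exists>xs. vertex_walk G (base ?x) xs (base ?y) \<and> Inl ` set xs \<subseteq> set zs
            \<and> length xs + height ?x + height ?y \<le> length zs"
    then obtain xs where "vertex_walk G v xs v" "Inl ` set xs \<subseteq> set zs" "length xs + 2 \<le> length zs"
      by auto
    then show ?thesis
      using vertex_walk_length_pos[of G v xs v] vertex_walk_hd_in_set[of G v xs v] by auto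
  qed auto
  \<comment> \<open>Distance 2 corresponds to a list of three vertices.\<close>
  have short: "geodesic H a as b \<Longrightarrow> gdist H a b \<le> ereal (real 2) \<longleftrightarrow> length as \<le> 3" for as
    using H.gdist_geodesic[of a as b] by auto
  show ?thesis
  proof
    assume "visible ?K (Q <+> Y) ?x ?y"
    then obtain zs where zs: "geodesic ?K ?x zs ?y" "set zs \<inter> (Q <+> Y) \<subseteq> {?x, ?y}"
      unfolding K.visible_iff_geodesic by blast
    then have "Inl v \<notin> set zs" using assms(6) by auto
    then obtain as where as: "vertex_walk H a as b" "zs = ?copy as"
      using project zs(1) unfolding geodesic_def by blast
    have "length as \<le> length bs" if "vertex_walk H a bs b" for bs
      using corona_walk_lift_copy[OF that assms(3)] zs(1) as(2) unfolding geodesic_def by fastforce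
    then have g: "geodesic H a as b" using as(1) by (simp add: geodesic_def)
    \<comment> \<open>Although blocked, the detour still limits the length of a shortest
      path.\<close>
    have "vertex_walk ?K ?x [?x, Inl v, ?y] ?y"
      using x assms by (auto simp: parcs_corona_iff intro!: vertex_walk.step[rotated] vertex_walk.trivial)
    then have "length as \<le> 3" using zs(1) as(2) unfolding geodesic_def by fastforce
    moreover have "set as \<inter> {c. (v, c) \<in> Y} \<subseteq> {a, b}" using zs(2) as(2) by auto
    ultimately show "visible H {c. (v, c) \<in> Y} a b \<and> gdist H a b \<le> ereal (real 2)"
      using g short[OF g] unfolding H.visible_iff_geodesic by blast
  next
    assume "visible H {c. (v, c) \<in> Y} a b \<and> gdist H a b \<le> ereal (real 2)"
    then obtain as where as: "geodesic H a as b" "set as \<inter> {c. (v, c) \<in> Y} \<subseteq> {a, b}" "length as \<le> 3"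
      using short unfolding H.visible_iff_geodesic by blast
    \<comment> \<open>Competitors that leave the copy have at least three vertices; the others come
      from walks of H, where \<open>as\<close> is minimal.\<close>
    have "length (?copy as) \<le> length zs" if "vertex_walk ?K ?x zs ?y" for zs
      using project[OF that] as(1,3) unfolding geodesic_def by fastforce
    then have "geodesic ?K ?x (?copy as) ?y"
      using corona_walk_lift_copy[of H a as b v G] assms(3) as(1) unfolding geodesic_def by blast
    then show "visible ?K (Q <+> Y) ?x ?y"
      unfolding K.visible_iff_geodesic using as(2) by fastforce
  qed
qed

section \<open>Symmetry of visibility and preliminary facts\<close>

lemma vertex_walk_rev:
  assumes "pair_graph G" "vertex_walk G u xs v"
  shows "vertex_walk G v (rev xs) u"
proof -
  interpret pair_graph G by fact
  show ?thesis
    using assms(2)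
  proof (induction rule: vertex_walk.induct)
    case (step u w xs v)
    have "(w, u) \<in> parcs G"
      using step.hyps(1) pair_sym_arcs by (auto simp: symmetric_def dest: symD)
    then show ?case
      using step vertex_walk_snoc[of G v "rev xs" w u] by (auto intro: in_arcsD1)
  qed (auto intro: vertex_walk.trivial)
qed

lemma visible_sym:
  assumes "pair_graph G" "visible G X u v"
  shows "visible G X v u"
proof -
  interpret pair_graph G by fact
  obtain xs where xs: "geodesic G u xs v" "set xs \<inter> X \<subseteq> {u, v}"
    using assms(2) unfolding visible_iff_geodesic by blast
  have "length (rev xs) \<le> length ys" if "vertex_walk G v ys u" for ys
    using vertex_walk_rev[OF assms(1) that] xs(1) unfolding geodesic_def by fastforce
  then have "geodesic G v (rev xs) u"
    using vertex_walk_rev[OF assms(1)] xs(1) unfolding geodesic_def by blast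
  then show ?thesis
    unfolding visible_iff_geodesic using xs(2) by (intro exI[of _ "rev xs"]) auto
qed

lemma set_diam_le_iff: "set_diam G X \<le> d \<longleftrightarrow> (\<forall>u\<in>X. \<forall>v\<in>X. gdist G u v \<le> d)"
  by (auto simp: set_diam_def SUP_le_iff)

lemma connected_imp_visible_empty:
  assumes "pair_graph G" "Digraph_Component.connected (with_proj G)" "u \<in> pverts G" "v \<in> pverts G"
  shows "visible G {} u v"
proof -
  interpret pair_graph G by fact
  show ?thesis
    unfolding visible_iff_geodesic using connected_imp_geodesic[OF assms] by auto
qed

section \<open>Mutual-visibility sets of the corona\<close>

lemma mutual_visibility_corona_Inl:
  assumes "pair_graph G" "pair_graph H"
  shows "mutual_visibility_set (corona G H) (Q <+> {}) \<longleftrightarrow> mutual_visibility_set G Q"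
proof -
  have "visible (corona G H) (Q <+> {}) (Inl u) (Inl v) \<longleftrightarrow> visible G Q u v"
    if "u \<in> pverts G" "v \<in> pverts G" for u v
    using that by (subst visible_corona_iff[OF assms]) (auto simp: pverts_corona)
  moreover have "Q <+> {} \<subseteq> pverts (corona G H) \<longleftrightarrow> Q \<subseteq> pverts G"
    by (auto simp: pverts_corona)
  moreover have "(\<forall>x\<in>Q <+> {}. P x) \<longleftrightarrow> (\<forall>u\<in>Q. P (Inl u))" for P :: "'a + 'a \<times> 'b \<Rightarrow> bool"
    by auto
  ultimately show ?thesis
    unfolding mutual_visibility_set_def visible_set_def by (simp add: subset_iff) blast
qed

text \<open>With no vertex of G selected nothing blocks: different copies are joined by a geodesic
  of G extended at both ends, and vertices of one copy see each other directly or through their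
  common neighbour in G.\<close>

lemma mutual_visibility_corona_Inr:
  assumes "pair_graph G" "pair_graph H" "Digraph_Component.connected (with_proj G)"
    and "Y \<subseteq> pverts G \<times> pverts H"
  shows "mutual_visibility_set (corona G H) ({} <+> Y)"
proof -
  have "visible (corona G H) ({} <+> Y) (Inr (v, a)) (Inr (w, b))"
    if "(v, a) \<in> Y" "(w, b) \<in> Y" for v a w b
  proof (cases "v = w")
    case True
    then show ?thesis
      using visible_corona_same_copy_free[OF assms(1,2), of v a b "{}" Y] assms(4) that by auto
  next
    case False
    then show ?thesis
      using that assms(4) connected_imp_visible_empty[OF assms(1,3)]
      by (subst visible_corona_iff[OF assms(1,2)]) (auto simp: pverts_corona)
  qed
  then show ?thesis
    using assms(4) unfolding mutual_visibility_set_def visible_set_def pverts_corona by auto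
qed

text \<open>A vertex \<open>v\<close> of \<open>Q\<close> with a point of \<open>Y\<close> in its
  copy cuts this point off from all selected vertices other than \<open>v\<close> and those of the
  same copy, which leaves the local case. Otherwise \<open>Y\<close> lies over vertices outside
  \<open>Q\<close>, and every condition is one on visibility in G.\<close>

lemma mutual_visibility_corona_Plus_iff:
  assumes G: "pair_graph G" and H: "pair_graph H"
    and Q: "Q \<noteq> {}" "Q \<subseteq> pverts G" and Y: "Y \<noteq> {}" "Y \<subseteq> pverts G \<times> pverts H"
  shows "mutual_visibility_set (corona G H) (Q <+> Y) \<longleftrightarrow>
     (\<exists>v B. Q = {v} \<and> Y = {v} \<times> B \<and> mutual_visibility_set H B \<and> set_diam H B \<le> ereal (real 2))
     \<or> abs_c_visible G Q (fst ` Y)" (is "?mv \<longleftrightarrow> ?local \<or> ?abs")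
proof -
  let ?vis = "visible (corona G H) (Q <+> Y)"
  interpret G: pair_graph G by fact
  interpret K: pair_graph "corona G H" using G H by (rule pair_graph_corona)
  have QQ: "?vis (Inl u) (Inl v) \<longleftrightarrow> visible G Q u v" if "u \<in> Q" "v \<in> Q" for u v
    using that Q by (subst visible_corona_iff[OF G H]) (auto simp: pverts_corona)
  have QY: "?vis (Inl u) (Inr p) \<longleftrightarrow> visible G Q u (fst p) \<and> (fst p \<in> Q \<longrightarrow> u = fst p)"
    if "u \<in> Q" "p \<in> Y" for u p
    using that Q Y by (subst visible_corona_iff[OF G H]) (auto simp: pverts_corona)
  have YQ: "?vis (Inr p) (Inl u) \<longleftrightarrow> ?vis (Inl u) (Inr p)" for u p
    using visible_sym[OF K.pair_graph_axioms] by blast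
  have YY: "?vis (Inr p) (Inr q) \<longleftrightarrow> visible G Q (fst p) (fst q) \<and> fst p \<notin> Q \<and> fst q \<notin> Q"
    if "p \<in> Y" "q \<in> Y" "fst p \<noteq> fst q" for p q
    using that Q Y by (subst visible_corona_iff[OF G H]) (auto simp: pverts_corona)
  have free: "?vis (Inr p) (Inr q)"
    if "p \<in> Y" "q \<in> Y" "fst p = fst q" "fst p \<notin> Q" for p q
    using visible_corona_same_copy_free[OF G H, of "fst p" "snd p" "snd q" Q Y] that Y
    by (cases p; cases q) auto
  have blocked: "?vis (Inr (v, a)) (Inr (v, b)) \<longleftrightarrow>
      visible H {c. (v, c) \<in> Y} a b \<and> gdist H a b \<le> ereal (real 2)"
    if "(v, a) \<in> Y" "(v, b) \<in> Y" "v \<in> Q" for v a b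
    using visible_corona_same_copy_blocked[OF G H, of v a b Q Y] that Y by auto
  \<comment> \<open>\<open>YY\<close> covers distinct bases only; pairs over the same vertex need
    visibility of that vertex from itself.\<close>
  have self: "visible G Q v v" if "v \<in> fst ` Y" for v
    using G.visible_self that Y by auto
  have mv: "?mv \<longleftrightarrow> (\<forall>u\<in>Q. \<forall>v\<in>Q. ?vis (Inl u) (Inl v)) \<and> (\<forall>u\<in>Q. \<forall>p\<in>Y. ?vis (Inl u) (Inr p))
      \<and> (\<forall>p\<in>Y. \<forall>q\<in>Y. ?vis (Inr p) (Inr q))"
    unfolding mutual_visibility_set_def visible_set_def pverts_corona using Q Y YQ
    by (auto simp: Plus_def)
  show ?thesis
  proof
    assume ?mv
    note m = this[unfolded mv]
    show "?local \<or> ?abs"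
    proof (cases "fst ` Y \<inter> Q = {}")
      case True
      have "visible G Q (fst p) (fst q)" if "p \<in> Y" "q \<in> Y" for p q
        using that m YY self by (cases "fst p = fst q") auto
      moreover have "visible G Q u (fst p)" if "u \<in> Q" "p \<in> Y" for u p
        using that m QY by blast
      moreover have "visible G Q u v" if "u \<in> Q" "v \<in> Q" for u v
        using that m QQ by blast
      ultimately have ?abs
        using True Q Y
        unfolding abs_c_visible_def c_visible_def mutual_visibility_set_def visible_set_def by auto
      then show ?thesis ..
    next
      case False
      \<comment> \<open>By \<open>QY\<close> the point over \<open>v\<close> is visible from no
        other vertex of \<open>Q\<close>, and by \<open>YY\<close> from no point over another
        vertex.\<close>
      then obtain v a where v: "(v, a) \<in> Y" "v \<in> Q" by auto
      then have "u = v" if "u \<in> Q" for u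
        using that m QY[OF that v(1)] by auto
      then have "Q = {v}" using v(2) by blast
      let ?B = "{c. (v, c) \<in> Y}"
      have "fst p = v" if "p \<in> Y" for p
        using m YY[OF v(1) that] v that by fastforce
      then have "Y = {v} \<times> ?B" by force
      moreover have "visible H ?B b c \<and> gdist H b c \<le> ereal (real 2)" if "b \<in> ?B" "c \<in> ?B" for b c
        using that m blocked[of v b c] v(2) by blast
      then have "mutual_visibility_set H ?B" "set_diam H ?B \<le> ereal (real 2)"
        using Y unfolding mutual_visibility_set_def visible_set_def set_diam_le_iff by auto
      ultimately show ?thesis using \<open>Q = {v}\<close> by blast
    qed
  next
    assume "?local \<or> ?abs"
    then show ?mv
    proof
      assume ?local
      then obtain v B where vB: "Q = {v}" "Y = {v} \<times> B" "mutual_visibility_set H B"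
        "set_diam H B \<le> ereal (real 2)" by blast
      then have "v \<in> pverts G" using Q by auto
      have "{c. (v, c) \<in> Y} = B" using vB(2) by auto
      then have "?vis (Inr (v, b)) (Inr (v, c))" if "b \<in> B" "c \<in> B" for b c
        using that blocked[of v b c] vB
        by (auto simp: set_diam_le_iff mutual_visibility_set_def visible_set_def)
      moreover have "?vis (Inl v) (Inl v)" "\<And>b. b \<in> B \<Longrightarrow> ?vis (Inl v) (Inr (v, b))"
        using QQ[of v v] QY[of v] vB G.visible_self[OF \<open>v \<in> pverts G\<close>] by auto
      ultimately show ?mv unfolding mv using vB(1,2) by auto
    next
      assume ?abs
      then have d: "fst p \<notin> Q" if "p \<in> Y" for p
        using that unfolding abs_c_visible_def c_visible_def by fastforce
      have a: "\<And>u v. u \<in> Q \<Longrightarrow> v \<in> Q \<Longrightarrow> visible G Q u v"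
        "\<And>u p. u \<in> Q \<Longrightarrow> p \<in> Y \<Longrightarrow> visible G Q u (fst p)"
        "\<And>p q. p \<in> Y \<Longrightarrow> q \<in> Y \<Longrightarrow> visible G Q (fst p) (fst q)"
        using \<open>?abs\<close>
        unfolding abs_c_visible_def c_visible_def mutual_visibility_set_def visible_set_def by auto
      \<comment> \<open>Since bases of \<open>Y\<close> avoid \<open>Q\<close>, pairs in one copy
        fall under \<open>free\<close> and all others under \<open>YY\<close>.\<close>
      have "?vis (Inr p) (Inr q)" if "p \<in> Y" "q \<in> Y" for p q
        using that YY[OF that] free[OF that] a(3) d by blast
      then show ?mv unfolding mv using QQ QY a d by blast
    qed
  qed
qed

subsection \<open>Generating functions of mutual-visibility sets\<close>

text \<open>Turns a coefficientwise definition into a weighted sum over the sets themselves, so that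
  splitting a family of sets splits its polynomial. The cutoff \<open>card V\<close> loses nothing,
  as members of \<open>A\<close> are subsets of \<open>V\<close>.\<close>

lemma sum_monom_card_eq:
  assumes "finite V" "\<And>X. X \<in> A \<Longrightarrow> X \<subseteq> V"
  shows "(\<Sum>i\<le>card V. monom (int (card {X \<in> A. card X = i})) i) = (\<Sum>X\<in>A. [:0, 1:] ^ card X)"
proof -
  have "finite A" using assms by (meson Pow_iff finite_Pow_iff finite_subset subsetI)
  have "monom (int (card {X \<in> A. card X = i})) i = (\<Sum>X | X \<in> A \<and> card X = i. [:0, 1:] ^ card X)" for i
    by (simp add: monom_altdef of_nat_poly)
  then show ?thesis
    using sum.group[OF \<open>finite A\<close>, of "{..card V}" card "\<lambda>X. [:0, 1:] ^ card X"] assms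
    by (auto simp: card_mono image_subset_iff)
qed

lemma visibility_poly_eq_sum:
  assumes "finite (pverts G)"
  shows "visibility_poly G = (\<Sum>X | mutual_visibility_set G X. [:0, 1:] ^ card X)"
  using sum_monom_card_eq[OF assms, of "{X. mutual_visibility_set G X}"]
  by (simp add: visibility_poly_def mutual_visibility_set_def)

lemma diam_visibility_poly_eq_sum:
  assumes "finite (pverts G)"
  shows "diam_visibility_poly d G =
    (\<Sum>X | mutual_visibility_set G X \<and> set_diam G X \<le> ereal (real d). [:0, 1:] ^ card X)"
  using sum_monom_card_eq[OF assms, of "{X. mutual_visibility_set G X \<and> set_diam G X \<le> ereal (real d)}"]
  by (simp add: diam_visibility_poly_def mutual_visibility_set_def conj_ac)

lemma sum_Pow_power_card:
  fixes x :: "'b :: comm_ring_1"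
  assumes "finite S"
  shows "(\<Sum>Y \<in> Pow S - {{}}. x ^ card Y) = (1 + x) ^ card S - 1"
proof -
  \<comment> \<open>Expand a product of factors x + 1 over \<open>S\<close>; \<open>Y\<close>
    records where x is chosen.\<close>
  have "(1 + x) ^ card S = (\<Sum>Y \<in> Pow S. x ^ card Y)"
    using prod_add[OF assms, of "\<lambda>_. x" "\<lambda>_. 1"] by (simp add: add.commute)
  then show ?thesis
    using assms by (simp add: sum_diff1)
qed

section \<open>Absolute visible sets and the polynomials p_Q\<close>

lemma abs_c_visible_antimono: "abs_c_visible G Q W \<Longrightarrow> W' \<subseteq> W \<Longrightarrow> abs_c_visible G Q W'"
  unfolding abs_c_visible_def c_visible_def visible_set_def by blast

lemma abs_c_visible_imp_max:
  assumes "finite (pverts G)" "abs_c_visible G Q W"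
  obtains W' where "W' \<in> max_abs_c_visible_sets G Q" "W \<subseteq> W'"
proof -
  have "finite {W. abs_c_visible G Q W}"
    using assms(1) by (rule finite_subset[rotated, OF finite_Pow_iff[THEN iffD2]])
      (auto simp: abs_c_visible_def c_visible_def)
  from finite_has_maximal2[OF this, of W] assms(2)
  show thesis using that unfolding max_abs_c_visible_sets_def by blast
qed

text \<open>Both cases of \<open>p_poly\<close> evaluate the weight of the same union of families
  \<open>B W\<close> over maximal \<open>W\<close>: by plain addition if the families are disjoint,
  by inclusion-exclusion otherwise.\<close>

lemma p_poly_eq_sum:
  assumes "finite (pverts G)" "finite V"
  shows "p_poly G (card V) Q =
    (\<Sum>Y | Y \<noteq> {} \<and> Y \<subseteq> pverts G \<times> V \<and> abs_c_visible G Q (fst ` Y). [:0, 1:] ^ (card Q + card Y))"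
proof -
  let ?\<Gamma> = "max_abs_c_visible_sets G Q"
  \<comment> \<open>Leaving out the empty set makes \<open>B W\<close> and \<open>B W'\<close>
    disjoint as soon as \<open>W\<close> and \<open>W'\<close> are.\<close>
  define B where "B W = Pow (W \<times> V) - {{}}" for W :: "'a set"
  define f :: "('a \<times> 'b) set set \<Rightarrow> int poly" where "f A = (\<Sum>Y\<in>A. [:0, 1:] ^ (card Q + card Y))" for A
  have sub: "W \<subseteq> pverts G" if "W \<in> ?\<Gamma>" for W
    using that by (auto simp: max_abs_c_visible_sets_def abs_c_visible_def c_visible_def)
  then have fin\<Gamma>: "finite ?\<Gamma>"
    using assms(1) by (meson Pow_iff finite_Pow_iff finite_subset subsetI)
  have finB: "finite (B W)" if "W \<subseteq> pverts G" for W
    using that assms finite_subset by (auto simp: B_def)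
  have fB: "f (B W) = ([:1, 1:] ^ (card W * card V) - 1) * [:0, 1:] ^ card Q" if "W \<subseteq> pverts G" for W
  proof -
    have "finite (W \<times> V)" using that assms finite_subset by blast
    from sum_Pow_power_card[OF this, of "[:0, 1:] :: int poly"] show ?thesis
      by (simp add: f_def B_def power_add card_cartesian_product one_pCons mult.commute flip: sum_distrib_left)
  qed
  have "{Y. Y \<noteq> {} \<and> Y \<subseteq> pverts G \<times> V \<and> abs_c_visible G Q (fst ` Y)} = \<Union> (B ` ?\<Gamma>)" (is "?L = ?R")
  proof
    show "?L \<subseteq> ?R"
    proof
      fix Y assume Y: "Y \<in> ?L"
      then obtain W where "W \<in> ?\<Gamma>" "fst ` Y \<subseteq> W" using abs_c_visible_imp_max[OF assms(1)] by blast
      with Y show "Y \<in> ?R" by (fastforce simp: B_def)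
    qed
    show "?R \<subseteq> ?L"
    proof
      fix Y assume "Y \<in> ?R"
      then obtain W where W: "W \<in> ?\<Gamma>" "Y \<subseteq> W \<times> V" "Y \<noteq> {}" by (auto simp: B_def)
      have "abs_c_visible G Q W" using W(1) by (simp add: max_abs_c_visible_sets_def)
      then have "abs_c_visible G Q (fst ` Y)"
        by (rule abs_c_visible_antimono) (use W(2) in auto)
      moreover have "Y \<subseteq> pverts G \<times> V" using W(2) sub[OF W(1)] by auto
      ultimately show "Y \<in> ?L" using W(3) by simp
    qed
  qed
  moreover have "p_poly G (card V) Q = f (\<Union> (B ` ?\<Gamma>))"
  proof (cases "disjoint_visible G Q")
    case True
    have "pairwise disjnt ?\<Gamma>"
    \<comment> \<open>With at most one maximal set \<open>disjoint_visible\<close> gives no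
      information, but pairwise disjointness is then trivial.\<close>
    proof (cases "card ?\<Gamma> > 1")
      case False
      then show ?thesis
        using fin\<Gamma> card_le_Suc0_iff_eq[of ?\<Gamma>] by (auto simp: pairwise_def)
    qed (use True in \<open>simp add: disjoint_visible_def\<close>)
    then have "B W \<inter> B W' = {}" if "W \<in> ?\<Gamma>" "W' \<in> ?\<Gamma>" "W \<noteq> W'" for W W'
      using that by (fastforce simp: B_def pairwise_def disjnt_def)
    then have "f (\<Union> (B ` ?\<Gamma>)) = (\<Sum>W\<in>?\<Gamma>. f (B W))"
      unfolding f_def using fin\<Gamma> finB sub by (intro sum.UNION_disjoint) auto
    also have "\<dots> = p_poly G (card V) Q"
      unfolding p_poly_def if_P[OF True] by (intro sum.cong refl fB sub)
    finally show ?thesis ..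
  next
    case False
    \<comment> \<open>Additivity on disjoint finite families is the condition of the locale
      \<open>Incl_Excl\<close>.\<close>
    have "f (S \<union> T) = f S + f T" if "finite S" "finite T" "disjnt S T" for S T
      using that unfolding f_def disjnt_def by (rule sum.union_disjoint)
    then have incl_excl: "Incl_Excl finite f"
      by (rule Incl_Excl.intro) simp_all
    have f_Inter: "f (\<Inter> (B ` J)) = ([:1, 1:] ^ (card (\<Inter>J) * card V) - 1) * [:0, 1:] ^ card Q"
      if "J \<noteq> {}" "J \<subseteq> ?\<Gamma>" for J
    proof -
      \<comment> \<open>In terms of the two projections of \<open>Y\<close>, membership commutes
        with intersections over a nonempty \<open>J\<close>.\<close>
      have mem_B: "Y \<in> B W \<longleftrightarrow> Y \<noteq> {} \<and> fst ` Y \<subseteq> W \<and> snd ` Y \<subseteq> V" for Y W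
        by (auto simp: B_def image_subset_iff subset_iff mem_Times_iff)
      have "\<Inter> (B ` J) = B (\<Inter>J)"
      proof (rule set_eqI)
        fix Y
        have "Y \<in> \<Inter> (B ` J) \<longleftrightarrow> Y \<noteq> {} \<and> (\<forall>W\<in>J. fst ` Y \<subseteq> W) \<and> snd ` Y \<subseteq> V"
          using that(1) by (simp add: mem_B ball_conj_distrib ex_in_conv)
        also have "\<dots> \<longleftrightarrow> Y \<in> B (\<Inter>J)"
          by (simp only: mem_B le_Inf_iff)
        finally show "Y \<in> \<Inter> (B ` J) \<longleftrightarrow> Y \<in> B (\<Inter>J)" .
      qed
      moreover have "\<Inter>J \<subseteq> pverts G" using that sub by blast
      ultimately show ?thesis using fB by simp
    qed
    have "p_poly G (card V) Q =
        (\<Sum>J | J \<subseteq> ?\<Gamma> \<and> J \<noteq> {}. (- 1) ^ (card J + 1) * f (\<Inter> (B ` J)))"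
      unfolding p_poly_def if_not_P[OF False] 
      by (rule sum.cong) (blast, simp add: f_Inter mult.assoc)
    \<comment> \<open>The indexed form sums over families of maximal sets \<open>W\<close>, as
      \<open>p_poly\<close> does, not over families of the sets \<open>B W\<close>.\<close>
    also have "\<dots> = f (\<Union> (B ` ?\<Gamma>))"
      using Incl_Excl.restricted_indexed[OF incl_excl fin\<Gamma>, of B] finB sub by simp
    finally show ?thesis .
  qed
  ultimately show ?thesis by (simp add: f_def)
qed

section \<open>Decomposition and summation\<close>

lemma bij_betw_Plus: "bij_betw (\<lambda>(A, B). A <+> B) {(A, B). P (A <+> B)} {X. P X}"
proof -
  have "z \<in> Inl -` X <+> Inr -` X \<longleftrightarrow> z \<in> X" for z :: "'a + 'b" and X
    by (cases z) auto
  then have "Inl -` X <+> Inr -` X = X" for X :: "('a + 'b) set" by blast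
  then show ?thesis
    \<comment> \<open>The inverse takes the preimages under the two injections.\<close>
    by (intro bij_betw_byWitness[where f' = "\<lambda>X. (Inl -` X, Inr -` X)"]) auto
qed

lemma finite_mutual_visibility_sets: "finite (pverts G) \<Longrightarrow> finite {X. mutual_visibility_set G X \<and> P X}"
  by (rule finite_subset[of _ "Pow (pverts G)"]) (auto simp: mutual_visibility_set_def)

lemma diam_visibility_poly_minus_1:
  assumes "finite (pverts G)"
  shows "diam_visibility_poly d G - 1 =
    (\<Sum>X \<in> {X. mutual_visibility_set G X \<and> set_diam G X \<le> ereal (real d)} - {{}}. [:0, 1:] ^ card X)"
proof -
  have "{} \<in> {X. mutual_visibility_set G X \<and> set_diam G X \<le> ereal (real d)}"
    by (simp add: mutual_visibility_set_def visible_set_def set_diam_le_iff)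
  then show ?thesis
    unfolding diam_visibility_poly_eq_sum[OF assms]
    using finite_mutual_visibility_sets[OF assms] by (subst sum_diff1) auto
qed

text \<open>The empty set is removed in the second and third classes so that pairs with empty
  \<open>Y\<close> are counted only in the first.\<close>

lemma mutual_visibility_corona_decomposition:
  assumes G: "pair_graph G" and conn: "Digraph_Component.connected (with_proj G)" and H: "pair_graph H"
  shows "{(Q, Y). mutual_visibility_set (corona G H) (Q <+> Y)} =
      {Q. mutual_visibility_set G Q} \<times> {{}}
    \<union> {{}} \<times> (Pow (pverts G \<times> pverts H) - {{}})
    \<union> (\<lambda>(v, B). ({v}, {v} \<times> B)) `
        (pverts G \<times> ({B. mutual_visibility_set H B \<and> set_diam H B \<le> ereal (real 2)} - {{}}))
    \<union> Sigma {Q. Q \<noteq> {} \<and> Q \<subset> pverts G \<and> mutual_visibility_set G Q}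
        (\<lambda>Q. {Y. Y \<noteq> {} \<and> Y \<subseteq> pverts G \<times> pverts H \<and> abs_c_visible G Q (fst ` Y)})"
    (is "?S = ?A \<union> ?B \<union> ?C \<union> ?D")
proof (intro set_eqI)
  fix z :: "'a set \<times> ('a \<times> 'b) set"
  obtain Q Y where z: "z = (Q, Y)" by fastforce
  let ?mv = "mutual_visibility_set (corona G H) (Q <+> Y)"
  have sub: "Q \<subseteq> pverts G \<and> Y \<subseteq> pverts G \<times> pverts H" if ?mv
    using that by (auto simp: mutual_visibility_set_def pverts_corona)
  consider "Y = {}" | "Y \<noteq> {}" "Q = {}" | "Y \<noteq> {}" "Q \<noteq> {}" by blast
  then show "z \<in> ?S \<longleftrightarrow> z \<in> ?A \<union> ?B \<union> ?C \<union> ?D"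
  proof cases
    case 1
    then show ?thesis using mutual_visibility_corona_Inl[OF G H] by (auto simp: z)
  next
    case 2
    then show ?thesis using mutual_visibility_corona_Inr[OF G H conn] sub by (auto simp: z)
  next
    case 3
    have C: "z \<in> ?C \<longleftrightarrow> Q \<subseteq> pverts G \<and> Y \<subseteq> pverts G \<times> pverts H \<and>
      (\<exists>v B. Q = {v} \<and> Y = {v} \<times> B \<and> mutual_visibility_set H B \<and> set_diam H B \<le> ereal (real 2))"
      using 3 by (auto simp: z mutual_visibility_set_def)
    \<comment> \<open>The bases of the nonempty \<open>Y\<close> lie outside \<open>Q\<close>, so
      \<open>Q\<close> is proper, as the range of the sum over \<open>Q\<close> requires.\<close>
    have "Q \<noteq> pverts G" "mutual_visibility_set G Q" if "abs_c_visible G Q (fst ` Y)"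
      using that 3(1) by (auto simp: abs_c_visible_def c_visible_def)
    then have D: "z \<in> ?D \<longleftrightarrow> Q \<subseteq> pverts G \<and> Y \<subseteq> pverts G \<times> pverts H \<and> abs_c_visible G Q (fst ` Y)"
      using 3 by (auto simp: z)
    have "z \<in> ?A \<union> ?B \<union> ?C \<union> ?D \<longleftrightarrow> z \<in> ?C \<or> z \<in> ?D"
      using 3 by (auto simp: z)
    moreover have "z \<in> ?S \<longleftrightarrow> ?mv" by (simp add: z)
    moreover have "?mv \<longleftrightarrow> z \<in> ?C \<or> z \<in> ?D"
    proof (cases "Q \<subseteq> pverts G \<and> Y \<subseteq> pverts G \<times> pverts H")
      case True
      then show ?thesis
        unfolding C D by (simp only: mutual_visibility_corona_Plus_iff[OF G H 3(2) _ 3(1)] simp_thms)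
    next
      case False
      then show ?thesis unfolding C D using sub by satx
    qed
    ultimately show ?thesis by (simp only:)
  qed
qed

theorem mainTheorem19:
  fixes G :: "'a pair_pre_digraph" and H :: "'b pair_pre_digraph" and m n :: nat
  assumes "pair_graph G" and "Digraph_Component.connected (with_proj G)"
    and "m = card (pverts G)" and "m > 1"
    and "pair_graph H" and "Digraph_Component.connected (with_proj H)"
    and "n = card (pverts H)"
  shows "visibility_poly (corona G H) =
           visibility_poly G + ([:1, 1:] ^ (m * n) - 1)
           + of_nat m * [:0, 1:] * (diam_visibility_poly 2 H - 1)
           + (\<Sum>Q \<in> {Q. Q \<noteq> {} \<and> Q \<subset> pverts G \<and> mutual_visibility_set G Q}. p_poly G n Q)"
proof -
  interpret G: pair_graph G by fact
  interpret H: pair_graph H by fact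
  interpret K: pair_graph "corona G H" using assms(1,5) by (rule pair_graph_corona)
  note fin = G.pair_finite_verts H.pair_finite_verts
  let ?x = "[:0, 1:] :: int poly"
  \<comment> \<open>The weight of \<open>Q <+> Y\<close>, with the exponent split so that it factors
    over the two components.\<close>
  define w where "w = (\<lambda>(Q :: 'a set, Y :: ('a \<times> 'b) set). ?x ^ (card Q + card Y))"
  let ?S = "{(Q, Y). mutual_visibility_set (corona G H) (Q <+> Y)}"
  define A where "A = {Q. mutual_visibility_set G Q} \<times> {{} :: ('a \<times> 'b) set}"
  define B where "B = {{} :: 'a set} \<times> (Pow (pverts G \<times> pverts H) - {{}})"
  define D where "D = {B. mutual_visibility_set H B \<and> set_diam H B \<le> ereal (real 2)} - {{}}"
  define C where "C = (\<lambda>(v, B). ({v}, {v} \<times> B)) ` (pverts G \<times> D)"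
  define P where "P = {Q. Q \<noteq> {} \<and> Q \<subset> pverts G \<and> mutual_visibility_set G Q}"
  define R where "R Q = {Y. Y \<noteq> {} \<and> Y \<subseteq> pverts G \<times> pverts H \<and> abs_c_visible G Q (fst ` Y)}" for Q
  have S: "?S = A \<union> B \<union> C \<union> Sigma P R"
    unfolding A_def B_def C_def D_def P_def R_def
    by (rule mutual_visibility_corona_decomposition) fact+
  have finA: "finite A" unfolding A_def
    using finite_mutual_visibility_sets[OF fin(1), of "\<lambda>_. True"] by simp
  have finB: "finite B" unfolding B_def using fin by simp
  have finD: "finite D" unfolding D_def using finite_mutual_visibility_sets[OF fin(2)] by simp
  then have finC: "finite C" unfolding C_def using fin by simp
  have finP: "finite P" unfolding P_def using fin(1)
    by (rule finite_subset[rotated, OF finite_Pow_iff[THEN iffD2]]) auto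
  have finR: "finite (R Q)" for Q
    by (rule finite_subset[of _ "Pow (pverts G \<times> pverts H)"]) (use fin in \<open>auto simp: R_def\<close>)
  have finPR: "finite (Sigma P R)" using finP finR by blast
  \<comment> \<open>The third and fourth classes differ because \<open>Y\<close> lies over
    \<open>Q\<close> in the one and over vertices outside \<open>Q\<close> in the other.\<close>
  have disj: "A \<inter> B = {}" "(A \<union> B) \<inter> C = {}" "(A \<union> B \<union> C) \<inter> Sigma P R = {}"
    by (auto simp: A_def B_def C_def D_def P_def R_def abs_c_visible_def c_visible_def split: if_splits)
  have wA: "sum w A = visibility_poly G"
    unfolding A_def w_def sum.cartesian_product[symmetric] visibility_poly_eq_sum[OF fin(1)]
    by simp
  have wB: "sum w B = [:1, 1:] ^ (m * n) - 1"
    using sum_Pow_power_card[OF finite_cartesian_product[OF fin], of ?x] assms(3,7)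
    unfolding B_def w_def sum.cartesian_product[symmetric]
    by (simp add: card_cartesian_product one_pCons)
  have "inj_on (\<lambda>(v, B). ({v}, {v} \<times> B)) (pverts G \<times> D)"
    by (auto simp: inj_on_def)
  \<comment> \<open>The singleton \<open>{v}\<close> contributes one factor x, and
    \<open>{v} \<times> B\<close> has as many elements as \<open>B\<close>.\<close>
  then have "sum w C = (\<Sum>(v, B) \<in> pverts G \<times> D. ?x * ?x ^ card B)"
    unfolding C_def by (subst sum.reindex) (auto simp: w_def card_cartesian_product intro!: sum.cong)
  also have "\<dots> = of_nat m * ?x * (diam_visibility_poly 2 H - 1)"
    unfolding diam_visibility_poly_minus_1[OF fin(2)] D_def[symmetric]
    by (simp add: assms(3) mult.assoc sum_distrib_left flip: sum.cartesian_product)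
  finally have wC: "sum w C = of_nat m * ?x * (diam_visibility_poly 2 H - 1)" .
  have wP: "sum w (Sigma P R) = (\<Sum>Q\<in>P. p_poly G n Q)"
    unfolding w_def using finP finR
    by (subst sum.Sigma[symmetric]) (simp_all add: p_poly_eq_sum[OF fin] assms(7) R_def)
  have "visibility_poly (corona G H) = (\<Sum>(Q, Y)\<in>?S. ?x ^ card (Q <+> Y))"
    unfolding visibility_poly_eq_sum[OF K.pair_finite_verts]
    using sum.reindex_bij_betw[OF bij_betw_Plus, of "\<lambda>X. ?x ^ card X" "mutual_visibility_set (corona G H)"]
    by (simp add: case_prod_unfold)
  also have "\<dots> = sum w ?S"
  proof (intro sum.cong refl)
    fix z assume "z \<in> ?S"
    then obtain Q Y where "z = (Q, Y)" "Q \<subseteq> pverts G" "Y \<subseteq> pverts G \<times> pverts H"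
      by (auto simp: mutual_visibility_set_def pverts_corona)
    moreover from this have "finite Q" "finite Y"
      using fin by (auto intro: finite_subset)
    ultimately show "(case z of (Q, Y) \<Rightarrow> ?x ^ card (Q <+> Y)) = w z"
      by (simp add: w_def card_Plus)
  qed
  also have "\<dots> = sum w A + sum w B + sum w C + sum w (Sigma P R)"
    unfolding S using finA finB finC finPR disj by (simp add: sum.union_disjoint)
  finally show ?thesis unfolding wA wB wC wP unfolding P_def .
qed

end
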